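(* Let $\lambda$ be a real number with $\lambda>-1$, $\lambda\neq0$, and let $x$ be a real variable. For every integer $n\ge1$, \[ \frac{\lambda}{\log(1+\lambda)}\frac{d}{dx}\mathrm{Bel}_{n,\lambda}(x)=\sum_{m=0}^{n-1}\binom{n}{m}\mathrm{Bel}_{m,\lambda}(x)\,(1\mid\lambda)_{n-m}. \]
   Context: The degenerate Bell polynomials $\mathrm{Bel}_{n,\lambda}(x)$ are defined by \[ (1+\lambda)^{\frac{x}{\lambda}\left((1+\lambda t)^{1/\lambda}-1\right)}=\exp\!\Big(\tfrac{x}{\lambda}\log(1+\lambda)\big((1+\lambda t)^{1/\lambda}-1\big)\Big)=\sum_{n=0}^{\infty}\mathrm{Bel}_{n,\lambda}(x)\frac{t^{n}}{n!}, \] with $(1+\lambda t)^{1/\lambda}=\exp(\tfrac1\lambda\log(1+\lambda t))$. For a number $a$, $(a\mid\lambda)_0=1$ and $(a\mid\lambda)_k=a(a-\lambda)(a-2\lambda)\cdots(a-(k-1)\lambda)$ for $k\ge1$. *)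

theory Defs
  imports "HOL-Complex_Analysis.Complex_Analysis"
begin

definition degen_falling :: "real \<Rightarrow> real \<Rightarrow> nat \<Rightarrow> real" where
  "degen_falling a l k = (\<Prod>i<k. a - real i * l)"

definition degen_Bell_gf :: "real \<Rightarrow> real \<Rightarrow> real \<Rightarrow> real" where
  "degen_Bell_gf l x t = (1 + l) powr (x / l * ((1 + l * t) powr (1 / l) - 1))"

text \<open>
  The sequence of degenerate Bell polynomials evaluated at \<open>x\<close> consists of the coefficients
  of the exponential generating function above. The lemmas
  \<open>degen_Bell_gf_has_fps_expansion\<close> and \<open>degen_Bell_unique\<close> below show that this description
  is well-defined when \<open>l > -1\<close> and \<open>l \<noteq> 0\<close>.
\<close>

definition degen_Bell :: "real \<Rightarrow> nat \<Rightarrow> real \<Rightarrow> real" where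
  "degen_Bell l n x =
     (THE b. degen_Bell_gf l x has_fps_expansion Abs_fps (\<lambda>k. b k / fact k)) n"

lemma degen_Bell_gf_eq_exp:
  assumes "l > -1" "l \<noteq> 0" "1 + l * t > 0"
  shows "degen_Bell_gf l x t =
           exp (x / l * ln (1 + l) * (exp (1 / l * ln (1 + l * t)) - 1))"
  using assms by (simp add: degen_Bell_gf_def powr_def mult_ac)

lemma real_fps_expansion_unique:
  fixes f :: "real \<Rightarrow> real"
  assumes "f has_fps_expansion F" "f has_fps_expansion G"
  shows "F = G"
proof -
  have iter: "(deriv ^^ n) f has_fps_expansion (fps_deriv ^^ n) H"
    if "f has_fps_expansion H" for H n
    using that by (induction n) (auto intro: has_fps_expansion_deriv)
  have nth: "fps_nth H n = (deriv ^^ n) f 0 / fact n" if "f has_fps_expansion H" for H n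
  proof -
    have "eval_fps ((fps_deriv ^^ n) H) 0 = (deriv ^^ n) f 0"
      using iter[OF that, of n] eventually_nhds_x_imp_x unfolding has_fps_expansion_def by fast
    then show ?thesis
      by (simp add: eval_fps_at_0 fps_0th_higher_deriv field_simps)
  qed
  show ?thesis
    by (rule fps_ext) (simp add: nth[OF assms(1)] nth[OF assms(2)])
qed

lemma degen_Bell_gf_expansion_ex:
  assumes "l > -1" "l \<noteq> 0"
  shows "\<exists>F. degen_Bell_gf l x has_fps_expansion F"
proof -
  define f :: "complex \<Rightarrow> complex" where
    "f = (\<lambda>z. exp (of_real (x / l * ln (1 + l)) *
                (exp (of_real (1 / l) * Ln (1 + of_real l * z)) - 1)))"
  have "f analytic_on {0}"
    unfolding f_def by (intro analytic_intros) auto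
  then have F: "f has_fps_expansion fps_expansion f 0"
    by (rule analytic_at_imp_has_fps_expansion_0)
  define F where "F = fps_expansion f 0"
  have "eventually (\<lambda>z. z \<in> eball 0 (fps_conv_radius F)) (nhds 0)"
    using F by (intro eventually_nhds_in_open)
      (auto simp: has_fps_expansion_def F_def zero_ereal_def)
  moreover have "eventually (\<lambda>z. eval_fps F z = f z) (nhds 0)"
    using F by (simp add: has_fps_expansion_def F_def)
  ultimately have "eventually (\<lambda>z. (\<lambda>n. fps_nth F n * z ^ n) sums f z) (nhds 0)"
  proof eventually_elim
    case (elim z)
    then have "summable (\<lambda>n. fps_nth F n * z ^ n)"
      by (intro summable_fps) auto
    with elim show ?case
      by (simp add: eval_fps_def sums_iff)
  qed
  moreover have "filterlim complex_of_real (nhds 0) (nhds 0)"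
    using tendsto_of_real[OF filterlim_ident[of "nhds (0::real)"], where 'a=complex] by simp
  ultimately have ev:
    "eventually (\<lambda>t. (\<lambda>n. fps_nth F n * complex_of_real t ^ n) sums f (of_real t)) (nhds 0)"
    by (rule eventually_compose_filterlim)
  have "filterlim (\<lambda>t. 1 + l * t) (nhds (1 + l * 0)) (nhds 0)"
    by (intro tendsto_intros filterlim_ident)
  then have ev2: "eventually (\<lambda>t. 1 + l * t > 0) (nhds 0)"
    by (intro order_tendstoD(1)[where y = "1 + l * 0"]) auto
  have "degen_Bell_gf l x has_fps_expansion Abs_fps (\<lambda>n. Re (fps_nth F n))"
  proof (rule has_fps_expansionI)
    show "eventually (\<lambda>t. (\<lambda>n. fps_nth (Abs_fps (\<lambda>n. Re (fps_nth F n))) n * t ^ n)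
            sums degen_Bell_gf l x t) (nhds 0)"
      using ev ev2
    proof eventually_elim
      case (elim t)
      have "Ln (1 + of_real l * of_real t) = of_real (ln (1 + l * t))"
        using Ln_of_real[OF elim(2)] by simp
      then have "f (of_real t) = of_real (degen_Bell_gf l x t)"
        unfolding f_def degen_Bell_gf_eq_exp[OF assms elim(2)]
        by (simp flip: exp_of_real)
      then have "(\<lambda>n. Re (fps_nth F n * complex_of_real t ^ n)) sums degen_Bell_gf l x t"
        using sums_Re[OF elim(1)] by simp
      then show ?case
        by (simp flip: of_real_power)
    qed
  qed
  then show ?thesis ..
qed

lemma degen_Bell_unique:
  assumes "degen_Bell_gf l x has_fps_expansion Abs_fps (\<lambda>k. b k / fact k)"
  shows "degen_Bell l n x = b n"
proof -
  have "c = b" if "degen_Bell_gf l x has_fps_expansion Abs_fps (\<lambda>k. c k / fact k)" for c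
    using real_fps_expansion_unique[OF that assms] by (auto simp: fps_eq_iff)
  with assms have "(THE b. degen_Bell_gf l x has_fps_expansion Abs_fps (\<lambda>k. b k / fact k)) = b"
    by (intro the_equality)
  then show ?thesis
    by (simp add: degen_Bell_def)
qed

lemma degen_Bell_gf_has_fps_expansion:
  assumes "l > -1" "l \<noteq> 0"
  shows "degen_Bell_gf l x has_fps_expansion Abs_fps (\<lambda>n. degen_Bell l n x / fact n)"
proof -
  obtain F where F: "degen_Bell_gf l x has_fps_expansion F"
    using degen_Bell_gf_expansion_ex[OF assms] by blast
  define b where "b = (\<lambda>n. fps_nth F n * fact n)"
  have "F = Abs_fps (\<lambda>n. b n / fact n)"
    by (simp add: b_def fps_eq_iff)
  with F have "degen_Bell_gf l x has_fps_expansion Abs_fps (\<lambda>n. b n / fact n)"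
    by simp
  then show ?thesis
    using degen_Bell_unique by simp
qed

end

theory Submission
  imports Defs
begin

text \<open>
  Put \<open>c = ln (1 + l) / l\<close>, and let \<open>H\<close> be the power series of \<open>(1 + l t) powr (1 / l) - 1\<close>.
  Comparing logarithmic derivatives in \<open>t\<close>, the generating function expands to the formal
  composition of \<open>exp (c x t)\<close> with \<open>H\<close>. As \<open>H\<close> has no constant term, each coefficient of
  this composition is a polynomial in \<open>x\<close>, and differentiating with respect to \<open>x\<close> multiplies
  the series by \<open>c H\<close>.
\<close>

text \<open>Coefficient \<open>k\<close> of \<open>A * (F - G)\<close> involves only coefficients of
  \<open>F - G\<close> up to index \<open>k\<close>, so the equation determines coefficient
  \<open>Suc k\<close> from earlier ones after division by \<open>Suc k\<close>, possible in
  characteristic zero.\<close>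

lemma fps_linear_ODE_unique:
  fixes F G A :: "'a :: field_char_0 fps"
  assumes "fps_deriv F = A * F" "fps_deriv G = A * G" "F $ 0 = G $ 0"
  shows "F = G"
proof -
  have "(F - G) $ n = 0" for n
  proof (induction n rule: less_induct)
    case (less n)
    show ?case
    proof (cases n)
      case 0
      then show ?thesis using assms(3) by simp
    next
      case (Suc k)
      have "fps_deriv (F - G) $ k = (A * (F - G)) $ k"
        using assms(1,2) by (simp add: algebra_simps)
      also have "\<dots> = 0"
        unfolding fps_mult_nth using less Suc by (intro sum.neutral) simp
      finally have "of_nat (Suc k) * (F - G) $ Suc k = 0"
        by simp
      then show ?thesis
        unfolding Suc using of_nat_neq_0[of k, where 'a='a] mult_eq_0_iff by blast
    qed
  qed
  then show ?thesis
    by (simp add: fps_eq_iff)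
qed

lemma fps_exp_compose_nth_has_real_derivative:
  fixes H :: "real fps"
  assumes "H $ 0 = 0"
  shows "((\<lambda>y. (fps_exp (c * y) oo H) $ n) has_real_derivative
            c * (H * (fps_exp (c * x) oo H)) $ n) (at x)"
proof -
  \<comment> \<open>\<open>H ^ i\<close> starts at degree \<open>i\<close> or later. A cutoff
    \<open>N\<close> independent of \<open>m\<close> gives all coefficients up to \<open>n\<close>
    the same range of summation, so that the sums can be swapped below.\<close>
  have nth: "(fps_exp y oo H) $ m = (\<Sum>i=0..N. y ^ i / fact i * (H ^ i) $ m)"
    if "m \<le> N" for y m N
    unfolding fps_compose_nth fps_exp_nth of_nat_fact
    using that assms by (intro sum.mono_neutral_left) (auto simp: startsby_zero_power_prefix)
  \<comment> \<open>The added top term is zero. Differentiation kills the term \<open>i = 0\<close>,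
    and shifting the index then leaves exactly the range \<open>0..n\<close>.\<close>
  have "((\<lambda>y. \<Sum>i=0..Suc n. (c * y) ^ i / fact i * (H ^ i) $ n) has_real_derivative
          (\<Sum>i=0..Suc n. of_nat i * (c * x) ^ (i - 1) * c / fact i * (H ^ i) $ n)) (at x)"
    by (intro DERIV_sum) (auto intro!: derivative_eq_intros)
  also have "(\<Sum>i=0..Suc n. of_nat i * (c * x) ^ (i - 1) * c / fact i * (H ^ i) $ n) =
      (\<Sum>i=0..n. c * ((c * x) ^ i / fact i * (H * H ^ i) $ n))"
    by (subst sum.atLeast0_atMost_Suc_shift)
       (auto intro!: sum.cong simp: field_simps simp del: of_nat_Suc)
  also have "\<dots> = c * (\<Sum>i=0..n. \<Sum>j=0..n. (c * x) ^ i / fact i * (H $ j * (H ^ i) $ (n - j)))"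
    by (simp add: fps_mult_nth sum_distrib_left)
  also have "\<dots> = c * (\<Sum>j=0..n. H $ j * (\<Sum>i=0..n. (c * x) ^ i / fact i * (H ^ i) $ (n - j)))"
    by (subst sum.swap) (simp add: sum_distrib_left mult_ac)
  also have "\<dots> = c * (H * (fps_exp (c * x) oo H)) $ n"
    unfolding fps_mult_nth by (simp add: nth[where N = n])
  finally show ?thesis
    by (simp only: nth[where N = "Suc n"] le_SucI order_refl)
qed

definition degen_exp_fps :: "real \<Rightarrow> real fps" where
  "degen_exp_fps l = Abs_fps (\<lambda>k. degen_falling 1 l k / fact k)"

text \<open>This is the binomial series with exponent \<open>1 / l\<close> at \<open>l * t\<close>:
  multiplying each factor \<open>1 / l - i\<close> by \<open>l\<close> gives
  \<open>1 - i * l\<close>.\<close>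

lemma degen_exp_has_fps_expansion:
  assumes "l \<noteq> 0"
  shows "(\<lambda>t. (1 + l * t) powr (1 / l)) has_fps_expansion degen_exp_fps l"
proof (rule has_fps_expansionI)
  have coeff: "((1 / l) gchoose k) * l ^ k = degen_falling 1 l k / fact k" for k
  proof -
    have "(\<Prod>i<k. 1 / l - real i) * l ^ k = (\<Prod>i<k. (1 / l - real i) * l)"
      by (simp add: prod.distrib)
    also have "\<dots> = degen_falling 1 l k"
      unfolding degen_falling_def using assms by (intro prod.cong) (auto simp: field_simps)
    finally show ?thesis
      by (simp add: gbinomial_prod_rev atLeast0LessThan)
  qed
  have "filterlim (\<lambda>t. \<bar>l * t\<bar>) (nhds \<bar>l * 0\<bar>) (nhds 0)"
    by (intro tendsto_intros filterlim_ident)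
  then have "eventually (\<lambda>t. \<bar>l * t\<bar> < 1) (nhds 0)"
    by (intro order_tendstoD(2)[where y = "\<bar>l * 0\<bar>"]) auto
  then show "eventually (\<lambda>t. (\<lambda>k. degen_exp_fps l $ k * t ^ k) sums
      (1 + l * t) powr (1 / l)) (nhds 0)"
  proof eventually_elim
    case (elim t)
    from gen_binomial_real[OF elim, of "1 / l"] show ?case
      by (simp add: degen_exp_fps_def power_mult_distrib mult.assoc flip: coeff)
  qed
qed

lemma degen_Bell_fps_eq:
  assumes "l > -1" "l \<noteq> 0"
  shows "Abs_fps (\<lambda>n. degen_Bell l n x / fact n) =
           fps_exp (ln (1 + l) / l * x) oo (degen_exp_fps l - 1)"
proof -
  define B where "B = Abs_fps (\<lambda>n. degen_Bell l n x / fact n)"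
  define c where "c = ln (1 + l) / l * x"
  define E where "E = degen_exp_fps l"
  let ?e = "\<lambda>t. (1 + l * t) powr (1 / l)"
  have gf: "degen_Bell_gf l x = (\<lambda>t. exp (c * (?e t - 1)))"
    using assms by (simp add: degen_Bell_gf_def powr_def[of "1 + l"] c_def fun_eq_iff field_simps)
  have B: "degen_Bell_gf l x has_fps_expansion B"
    unfolding B_def by (rule degen_Bell_gf_has_fps_expansion[OF assms])
  have E: "?e has_fps_expansion E"
    unfolding E_def by (rule degen_exp_has_fps_expansion[OF assms(2)])
  have E0: "E $ 0 = 1"
    by (simp add: E_def degen_exp_fps_def degen_falling_def)
  have "B $ 0 = degen_Bell_gf l x 0"
    using B eventually_nhds_x_imp_x[of "\<lambda>t. eval_fps B t = degen_Bell_gf l x t" 0]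
    by (auto simp: has_fps_expansion_def eval_fps_at_0)
  then have B0: "B $ 0 = 1"
    by (simp add: gf)
  have "filterlim (\<lambda>t. 1 + l * t) (nhds (1 + l * 0)) (nhds 0)"
    by (intro tendsto_intros filterlim_ident)
  then have "eventually (\<lambda>t. 1 + l * t > 0) (nhds 0)"
    by (intro order_tendstoD(1)[where y = "1 + l * 0"]) auto
  \<comment> \<open>Keeping \<open>deriv ?e\<close> unevaluated lets its expansion be read off as
    \<open>fps_deriv E\<close>.\<close>
  then have ev: "eventually (\<lambda>t. deriv (degen_Bell_gf l x) t =
      c * deriv ?e t * degen_Bell_gf l x t) (nhds 0)"
  proof eventually_elim
    case (elim t)
    then have "?e field_differentiable at t"
      unfolding field_differentiable_def
      by (intro exI) (rule derivative_eq_intros refl | simp)+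
    then have "(?e has_real_derivative deriv ?e t) (at t)"
      by (simp add: DERIV_deriv_iff_field_differentiable)
    then have "((\<lambda>s. exp (c * (?e s - 1))) has_real_derivative
        exp (c * (?e t - 1)) * (c * (deriv ?e t - 0))) (at t)"
      by (intro DERIV_fun_exp DERIV_cmult DERIV_diff DERIV_const)
    then show ?case
      unfolding gf by (simp add: DERIV_imp_deriv)
  qed
  have "(\<lambda>t. c * deriv ?e t * degen_Bell_gf l x t) has_fps_expansion fps_const c * fps_deriv E * B"
    by (intro fps_expansion_intros B E)
  then have "deriv (degen_Bell_gf l x) has_fps_expansion fps_const c * fps_deriv E * B"
    using has_fps_expansion_cong[OF ev refl] by blast
  then have "fps_deriv B = fps_const c * fps_deriv E * B"
    using has_fps_expansion_deriv[OF B] real_fps_expansion_unique by blast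
  \<comment> \<open>The formal chain rule applies because \<open>E - 1\<close> has no constant
    term.\<close>
  moreover have "fps_deriv (fps_exp c oo (E - 1)) =
      fps_const c * fps_deriv E * (fps_exp c oo (E - 1))"
    using E0 by (simp add: fps_compose_deriv fps_compose_mult_distrib mult_ac)
  ultimately have "B = fps_exp c oo (E - 1)"
    by (rule fps_linear_ODE_unique) (simp add: B0)
  then show ?thesis
    by (simp add: B_def c_def E_def)
qed

theorem theorem8:
  fixes l x :: real and n :: nat
  assumes "l > -1" and "l \<noteq> 0" and "n \<ge> 1"
  shows "(\<lambda>y. degen_Bell l n y) differentiable (at x) \<and>
         l / ln (1 + l) * deriv (\<lambda>y. degen_Bell l n y) x =
           (\<Sum>m=0..n-1. real (n choose m) * degen_Bell l m x * degen_falling 1 l (n - m))"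
proof -
  define c where "c = ln (1 + l) / l"
  define H where "H = degen_exp_fps l - 1"
  let ?B = "\<lambda>y. fps_exp (c * y) oo H"
  have H0: "H $ 0 = 0"
    by (simp add: H_def degen_exp_fps_def degen_falling_def)
  have Hnth: "H $ k = degen_falling 1 l k / fact k" if "k > 0" for k
    using that by (simp add: H_def degen_exp_fps_def)
  have Bell: "degen_Bell l m y = fact m * ?B y $ m" for m y
    using arg_cong[OF degen_Bell_fps_eq[OF assms(1,2), of y], of "\<lambda>F. fact m * F $ m"]
    by (simp add: c_def H_def)
  have "((\<lambda>y. fact n * ?B y $ n) has_real_derivative fact n * (c * (H * ?B x) $ n)) (at x)"
    by (intro DERIV_cmult fps_exp_compose_nth_has_real_derivative H0)
  then have D: "((\<lambda>y. degen_Bell l n y) has_real_derivative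
      fact n * (c * (H * ?B x) $ n)) (at x)"
    by (simp add: Bell)
  \<comment> \<open>Nonzero because \<open>1 + l\<close> is positive and differs from 1; the
    prefactor \<open>l / ln (1 + l)\<close> is thus the inverse of \<open>c\<close>.\<close>
  have "c \<noteq> 0"
    using assms by (simp add: c_def)
  then have "l / ln (1 + l) * deriv (\<lambda>y. degen_Bell l n y) x = fact n * (?B x * H) $ n"
    unfolding DERIV_imp_deriv[OF D] using assms by (simp add: c_def mult.commute)
  \<comment> \<open>The term \<open>m = n\<close> of the Cauchy product drops out by
    \<open>H0\<close>.\<close>
  also have "\<dots> = (\<Sum>m=0..n-1. fact n * (?B x $ m * H $ (n - m)))"
    using assms(3) H0 by (cases n) (simp_all add: fps_mult_nth sum_distrib_left)
  also have "\<dots> = (\<Sum>m=0..n-1. real (n choose m) * degen_Bell l m x * degen_falling 1 l (n - m))"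
    using assms(3) by (intro sum.cong) (auto simp: Bell Hnth binomial_fact)
  finally show ?thesis
    using D real_differentiable_def by blast
qed

end
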